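(* Suppose $n\geq 1$. Then (1) $\sum_{\sigma\in \mathfrak{S}_n}\mathrm{sdes}(\sigma)=(n-1)(n-1)!$; (2) $\sum_{\sigma\in \mathfrak{S}_n}\mathrm{sinv}(\sigma)=\binom{n}{2}(n-1)!=\frac{n!(n-1)}{2}$; (3) $\sum_{\sigma\in \mathfrak{S}_n}\mathrm{bdes}(\sigma)=\frac{(n-1)(n-2)(n-1)!}{2}$; (4) $\sum_{\sigma\in \mathfrak{S}_n}\mathrm{binv}(\sigma)=\frac{(n-1)(n-2)\, n!}{4}$.
   Context: $\mathfrak{S}_n$ is the set of permutations of $[n]$, written as words. For a word $w=w_1\cdots w_n$ of positive integers: $\mathrm{sdes}(w)$ (small descents) is the number of $i\in[n-1]$ with $w_i=w_{i+1}+1$; $\mathrm{sinv}(w)$ (small inversions) is the number of pairs $1\le i<j\le n$ with $w_i=w_j+1$; $\mathrm{bdes}(w)$ (big descents) is the number of $i\in[n-1]$ with $w_i>w_{i+1}+1$; $\mathrm{binv}(w)$ (big inversions) is the number of pairs $1\le i<j\le n$ with $w_i>w_j+1$. *)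

theory Defs
  imports Complex_Main "HOL-Combinatorics.Multiset_Permutations"
begin

text \<open>
  A word is a \<^typ>\<open>nat list\<close>. List positions are counted from 0, so the letter \<open>w\<^sub>i\<close> is
  \<open>w ! (i - 1)\<close>. The set of permutations of \<open>{1, \<dots>, n}\<close>, written as words, is
  \<open>permutations_of_set {1..n}\<close>.
\<close>

definition sdes :: "nat list \<Rightarrow> nat" where
  "sdes w = card {i. i + 1 < length w \<and> w ! i = w ! (i + 1) + 1}"

definition sinv :: "nat list \<Rightarrow> nat" where
  "sinv w = card {(i, j). i < j \<and> j < length w \<and> w ! i = w ! j + 1}"

definition bdes :: "nat list \<Rightarrow> nat" where
  "bdes w = card {i. i + 1 < length w \<and> w ! i > w ! (i + 1) + 1}"

definition binv :: "nat list \<Rightarrow> nat" where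
  "binv w = card {(i, j). i < j \<and> j < length w \<and> w ! i > w ! j + 1}"

end

theory Submission
  imports Defs
begin

text \<open>
  All four statistics count occurrences of one kind: pairs of positions \<open>(i, j)\<close> in a fixed set
  \<open>P\<close> (adjacent positions for descents, all pairs \<open>i < j\<close> for inversions) whose letters
  \<open>(\<sigma>\<^sub>i, \<sigma>\<^sub>j)\<close> lie in a fixed set \<open>R\<close> of pairs of distinct values (differing by
  exactly one for the small statistics, by more than one for the big ones).

  For \<open>n = 1\<close> all statistics vanish. Let \<open>n \<ge> 2\<close>. By symmetry under relabelling the values, the
  letters at two given distinct positions are equally often each of the \<open>n (n - 1)\<close> pairs of
  distinct values, so each pair of values occurs there in \<open>n! / (n (n - 1)) = (n - 2)!\<close> permutations
  (\<open>card_permutations_with_two_letters\<close>).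
  Exchanging the order of summation, the total of such a statistic is
  \<open>|P| |R| (n - 2)!\<close> (\<open>sum_pattern_occurrences\<close>). There are \<open>n - 1\<close> adjacent pairs of positions and
  \<open>n choose 2\<close> pairs \<open>i < j\<close>; likewise \<open>n - 1\<close> pairs of values \<open>(b + 1, b)\<close> and \<open>(n - 1) choose 2\<close>
  pairs \<open>(a, b)\<close> with \<open>a > b + 1\<close>. The four combinations give the four formulas.
\<close>

lemma ex_permutes_moving_pair:
  assumes "a \<in> A" "b \<in> A" "a \<noteq> b" "a' \<in> A" "b' \<in> A" "a' \<noteq> b'"
  shows "\<exists>f. f permutes A \<and> f a = a' \<and> f b = b'"
proof -
  define c where "c = transpose a a' b"
  \<comment> \<open>The first transposition puts \<open>a\<close> in place and sends \<open>b\<close> to \<open>c\<close>; the second moves \<open>c\<close> to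
    \<open>b'\<close> and leaves \<open>a'\<close> alone because \<open>a'\<close> is neither \<open>c\<close> nor \<open>b'\<close>.\<close>
  define f where "f = transpose c b' \<circ> transpose a a'"
  have c: "c \<in> A" "c \<noteq> a'"
    using assms by (auto simp: c_def transpose_def)
  have "f permutes A"
    unfolding f_def using assms c by (intro permutes_compose permutes_swap_id) auto
  moreover have "f a = a'" "f b = b'"
    using assms c by (simp_all add: f_def flip: c_def)
  ultimately show ?thesis by blast
qed

lemma card_permutations_with_two_letters_le:
  fixes A :: "'a set"
  assumes "finite A" "i < card A" "j < card A"
    and "a \<in> A" "b \<in> A" "a \<noteq> b" "a' \<in> A" "b' \<in> A" "a' \<noteq> b'"
  shows "card {w \<in> permutations_of_set A. w ! i = a \<and> w ! j = b}
       \<le> card {w \<in> permutations_of_set A. w ! i = a' \<and> w ! j = b'}"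
proof -
  obtain f where f: "f permutes A" "f a = a'" "f b = b'"
    using ex_permutes_moving_pair assms(4-9) by metis
  have "map f w \<in> permutations_of_set A" if "w \<in> permutations_of_set A" for w
    using that permutations_of_set_image_inj[of f A] permutes_image[OF f(1)]
      permutes_inj_on[OF f(1)] by (metis imageI)
  then show ?thesis
    using assms f permutes_inj[OF f(1)]
    by (intro card_inj_on_le[of "map f"])
       (auto simp: inj_on_def length_finite_permutations_of_set)
qed

text \<open>
  The permutations are partitioned by their letters at positions \<open>i\<close> and \<open>j\<close>. Relabelling makes the
  \<open>n (n - 1)\<close> classes equinumerous, which determines their common size.
\<close>

lemma card_permutations_with_two_letters:
  fixes A :: "'a set"
  assumes "finite A" "i < card A" "j < card A" "i \<noteq> j"
    and "a \<in> A" "b \<in> A" "a \<noteq> b"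
  shows "card {w \<in> permutations_of_set A. w ! i = a \<and> w ! j = b} = fact (card A - 2)"
proof -
  define C where "C = (\<lambda>(a, b). {w \<in> permutations_of_set A. w ! i = a \<and> w ! j = b})"
  define D where "D = Sigma A (\<lambda>a. A - {a})"
  have letters: "(w ! i, w ! j) \<in> D" if "w \<in> permutations_of_set A" for w
  proof -
    have "distinct w" "set w = A" "length w = card A"
      using that by (auto dest: permutations_of_setD length_finite_permutations_of_set)
    then have "w ! i \<in> A" "w ! j \<in> A" "w ! i \<noteq> w ! j"
      using assms(2-4) nth_mem[of i w] nth_mem[of j w] nth_eq_iff_index_eq[of w i j] by simp_all
    then show ?thesis by (simp add: D_def)
  qed
  have "card (C p) = card (C (a, b))" if "p \<in> D" for p
    using that assms(1-3,5-) unfolding C_def D_def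
    by (auto intro!: antisym card_permutations_with_two_letters_le)
  then have "(\<Sum>p\<in>D. card (C p)) = card D * card (C (a, b))"
    by simp
  moreover have "card D = card A * (card A - 1)"
    using assms(1) by (simp add: D_def)
  moreover have "permutations_of_set A = (\<Union>p\<in>D. C p)"
    using letters by (auto simp: C_def)
  moreover have "card (\<Union>p\<in>D. C p) = (\<Sum>p\<in>D. card (C p))"
    using assms(1) by (intro card_UN_disjoint) (auto simp: C_def D_def)
  ultimately have "card A * (card A - 1) * card (C (a, b)) = fact (card A)"
    using card_permutations_of_set[OF assms(1)] by simp
  moreover obtain m where "card A = Suc (Suc m)"
    using assms(2-4) by (metis One_nat_def less_one less_zeroE not0_implies_Suc)
  ultimately have "(Suc (Suc m) * Suc m) * card (C (a, b)) = (Suc (Suc m) * Suc m) * fact m"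
    by (simp only: fact_Suc of_nat_id mult.assoc diff_Suc_1)
  then have "card (C (a, b)) = fact m"
    by (simp only: mult_cancel1) simp
  then show ?thesis
    using \<open>card A = Suc (Suc m)\<close> by (simp add: C_def)
qed

text \<open>
  Double counting of the triples consisting of a permutation, a pair of positions in \<open>P\<close> and a pair
  of values in \<open>R\<close> that stands there. If \<open>A\<close> has fewer than two elements, \<open>P\<close> is empty and
  both sides vanish.
\<close>

lemma sum_pattern_occurrences:
  fixes A :: "'a set"
  assumes "finite A"
    and P: "P \<subseteq> {(i, j). i < card A \<and> j < card A \<and> i \<noteq> j}"
    and R: "R \<subseteq> {(a, b). a \<in> A \<and> b \<in> A \<and> a \<noteq> b}"
  shows "(\<Sum>w\<in>permutations_of_set A. card {(i, j) \<in> P. (w ! i, w ! j) \<in> R})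
       = card P * card R * fact (card A - 2)"
proof -
  have "finite P" "finite R"
    using finite_subset[OF P finite_subset[of _ "{..<card A} \<times> {..<card A}"]]
      finite_subset[OF R finite_subset[of _ "A \<times> A"]] assms(1) by auto
  have "card {(i, j) \<in> P. (w ! i, w ! j) \<in> R}
      = (\<Sum>(i, j)\<in>P. \<Sum>(a, b)\<in>R. if w ! i = a \<and> w ! j = b then 1 else 0)" for w :: "'a list"
  proof -
    have "(\<Sum>(a, b)\<in>R. if x = a \<and> y = b then 1 else 0) = (if (x, y) \<in> R then 1 else (0::nat))"
      for x y
    proof -
      have "(\<Sum>(a, b)\<in>R. if x = a \<and> y = b then 1 else 0) = (\<Sum>p\<in>R. if (x, y) = p then 1 else (0::nat))"
        by (simp add: case_prod_unfold prod_eq_iff)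
      then show ?thesis
        using \<open>finite R\<close> by simp
    qed
    then show ?thesis
      using \<open>finite P\<close> by (simp add: case_prod_unfold flip: sum.inter_filter)
  qed
  then have "(\<Sum>w\<in>permutations_of_set A. card {(i, j) \<in> P. (w ! i, w ! j) \<in> R})
      = (\<Sum>w\<in>permutations_of_set A. \<Sum>(i, j)\<in>P. \<Sum>(a, b)\<in>R.
          if w ! i = a \<and> w ! j = b then 1 else 0)"
    by simp
  also have "\<dots> = (\<Sum>(i, j)\<in>P. \<Sum>(a, b)\<in>R. \<Sum>w\<in>permutations_of_set A.
          if w ! i = a \<and> w ! j = b then 1 else 0)"
    unfolding case_prod_unfold
    by (subst sum.swap, rule sum.cong[OF refl], subst sum.swap, rule refl)
  also have "\<dots> = (\<Sum>(i, j)\<in>P. \<Sum>(a, b)\<in>R.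
      card {w \<in> permutations_of_set A. w ! i = a \<and> w ! j = b})"
    by (simp add: case_prod_unfold flip: sum.inter_filter)
  also have "\<dots> = (\<Sum>(i, j)\<in>P. \<Sum>(a, b)\<in>R. fact (card A - 2))"
    unfolding case_prod_unfold using P R assms(1)
    by (intro sum.cong refl card_permutations_with_two_letters) auto
  finally show ?thesis
    by (simp add: case_prod_unfold)
qed

definition adjacent_positions :: "nat \<Rightarrow> (nat \<times> nat) set" where
  "adjacent_positions n = (\<lambda>i. (i, i + 1)) ` {..<n - 1}"

definition ordered_positions :: "nat \<Rightarrow> (nat \<times> nat) set" where
  "ordered_positions n = {(i, j). i < j \<and> j < n}"

definition small_drops :: "nat \<Rightarrow> (nat \<times> nat) set" where
  "small_drops n = {(a, b). a \<in> {1..n} \<and> b \<in> {1..n} \<and> a = b + 1}"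

definition big_drops :: "nat \<Rightarrow> (nat \<times> nat) set" where
  "big_drops n = {(a, b). a \<in> {1..n} \<and> b \<in> {1..n} \<and> a > b + 1}"

lemma card_adjacent_positions: "card (adjacent_positions n) = n - 1"
  by (simp add: adjacent_positions_def card_image inj_on_def)

lemma card_ordered_positions: "card (ordered_positions n) = n choose 2"
proof -
  have "ordered_positions n = prod.swap ` (SIGMA j:{..<n}. {..<j})"
    by (auto simp: ordered_positions_def image_iff)
  then have "card (ordered_positions n) = (\<Sum>j<n. j)"
    by (simp add: card_image)
  also have "\<dots> = n choose 2"
    by (induction n) (simp_all add: numeral_2_eq_2)
  finally show ?thesis .
qed

lemma card_small_drops: "card (small_drops n) = n - 1"
proof -
  have "small_drops n = (\<lambda>b. (b + 1, b)) ` {1..n - 1}"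
    by (auto simp: small_drops_def)
  then show ?thesis
    by (simp add: card_image inj_on_def)
qed

lemma card_big_drops: "card (big_drops n) = (n - 1) choose 2"
proof -
  \<comment> \<open>Lowering the larger value by one turns the gap condition into a strict inequality; the
    remaining shift by one passes from values \<open>1, \<dots>, n - 1\<close> to positions \<open>0, \<dots>, n - 2\<close>.\<close>
  have "big_drops n = (\<lambda>(i, j). (j + 2, i + 1)) ` ordered_positions (n - 1)"
  proof (intro equalityI subsetI)
    fix p assume "p \<in> big_drops n"
    then show "p \<in> (\<lambda>(i, j). (j + 2, i + 1)) ` ordered_positions (n - 1)"
      by (intro image_eqI[of _ _ "(snd p - 1, fst p - 2)"])
         (auto simp: big_drops_def ordered_positions_def)
  qed (auto simp: big_drops_def ordered_positions_def)
  moreover have "inj_on (\<lambda>(i, j). (j + 2, i + 1)) (ordered_positions (n - 1))"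
    by (auto simp: inj_on_def)
  ultimately show ?thesis
    by (simp add: card_image card_ordered_positions)
qed

lemma statistics_as_pattern_occurrences:
  assumes "w \<in> permutations_of_set {1..n}"
  shows "sdes w = card {(i, j) \<in> adjacent_positions n. (w ! i, w ! j) \<in> small_drops n}"
    and "sinv w = card {(i, j) \<in> ordered_positions n. (w ! i, w ! j) \<in> small_drops n}"
    and "bdes w = card {(i, j) \<in> adjacent_positions n. (w ! i, w ! j) \<in> big_drops n}"
    and "binv w = card {(i, j) \<in> ordered_positions n. (w ! i, w ! j) \<in> big_drops n}"
proof -
  have len: "length w = n"
    using length_finite_permutations_of_set[OF assms] by simp
  then have letter: "w ! i \<in> {1..n}" if "i < n" for i
    using that permutations_of_setD(1)[OF assms] by (metis nth_mem)
  have adjacent: "card {i. i + 1 < length w \<and> Q (w ! i) (w ! (i + 1))}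
      = card {(i, j) \<in> adjacent_positions n. (w ! i, w ! j) \<in> R}"
    if "\<And>a b. a \<in> {1..n} \<Longrightarrow> b \<in> {1..n} \<Longrightarrow> (a, b) \<in> R \<longleftrightarrow> Q a b" for Q R
  proof -
    have "{(i, j) \<in> adjacent_positions n. (w ! i, w ! j) \<in> R}
        = (\<lambda>i. (i, i + 1)) ` {i. i + 1 < length w \<and> Q (w ! i) (w ! (i + 1))}"
      using that letter len by (auto simp: adjacent_positions_def less_diff_conv)
    then show ?thesis
      by (simp add: card_image inj_on_def)
  qed
  have ordered: "{(i, j). i < j \<and> j < length w \<and> Q (w ! i) (w ! j)}
      = {(i, j) \<in> ordered_positions n. (w ! i, w ! j) \<in> R}"
    if "\<And>a b. a \<in> {1..n} \<Longrightarrow> b \<in> {1..n} \<Longrightarrow> (a, b) \<in> R \<longleftrightarrow> Q a b" for Q R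
    using that letter len by (auto simp: ordered_positions_def)
  show "sdes w = card {(i, j) \<in> adjacent_positions n. (w ! i, w ! j) \<in> small_drops n}"
    unfolding sdes_def by (rule adjacent) (simp add: small_drops_def)
  show "bdes w = card {(i, j) \<in> adjacent_positions n. (w ! i, w ! j) \<in> big_drops n}"
    unfolding bdes_def by (rule adjacent) (simp add: big_drops_def)
  show "sinv w = card {(i, j) \<in> ordered_positions n. (w ! i, w ! j) \<in> small_drops n}"
    unfolding sinv_def by (rule arg_cong[OF ordered]) (simp add: small_drops_def)
  show "binv w = card {(i, j) \<in> ordered_positions n. (w ! i, w ! j) \<in> big_drops n}"
    unfolding binv_def by (rule arg_cong[OF ordered]) (simp add: big_drops_def)
qed

theorem proposition5p17:
  fixes n :: nat
  assumes "n \<ge> 1"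
  shows "(\<Sum>\<sigma>\<in>permutations_of_set {1..n}. sdes \<sigma>) = (n - 1) * fact (n - 1)
    \<and> (\<Sum>\<sigma>\<in>permutations_of_set {1..n}. sinv \<sigma>) = (n choose 2) * fact (n - 1)
    \<and> real ((n choose 2) * fact (n - 1)) = fact n * (real n - 1) / 2
    \<and> real (\<Sum>\<sigma>\<in>permutations_of_set {1..n}. bdes \<sigma>)
           = (real n - 1) * (real n - 2) * fact (n - 1) / 2
    \<and> real (\<Sum>\<sigma>\<in>permutations_of_set {1..n}. binv \<sigma>)
           = (real n - 1) * (real n - 2) * fact n / 4"
proof -
  have total: "(\<Sum>\<sigma>\<in>permutations_of_set {1..n}. card {(i, j) \<in> P. (\<sigma> ! i, \<sigma> ! j) \<in> R})
      = card P * card R * fact (n - 2)"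
    if "P \<in> {adjacent_positions n, ordered_positions n}" "R \<in> {small_drops n, big_drops n}" for P R
    using that by (subst sum_pattern_occurrences)
      (auto simp: adjacent_positions_def ordered_positions_def small_drops_def big_drops_def)
  have sums:
    "(\<Sum>\<sigma>\<in>permutations_of_set {1..n}. sdes \<sigma>) = (n - 1) * (n - 1) * fact (n - 2)"
    "(\<Sum>\<sigma>\<in>permutations_of_set {1..n}. sinv \<sigma>) = (n choose 2) * (n - 1) * fact (n - 2)"
    "(\<Sum>\<sigma>\<in>permutations_of_set {1..n}. bdes \<sigma>) = (n - 1) * ((n - 1) choose 2) * fact (n - 2)"
    "(\<Sum>\<sigma>\<in>permutations_of_set {1..n}. binv \<sigma>)
       = (n choose 2) * ((n - 1) choose 2) * fact (n - 2)"
    by (simp_all only: statistics_as_pattern_occurrences total card_adjacent_positions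
        card_ordered_positions card_small_drops card_big_drops insert_iff simp_thms
        cong: sum.cong)
  have choose2: "real (k choose 2) = real k * (real k - 1) / 2" for k
    by (induction k) (simp_all add: numeral_2_eq_2 field_simps)
  \<comment> \<open>For \<open>n = 1\<close> the truncated factor \<open>fact (n - 2)\<close> is \<open>1\<close> and all sums are zero.\<close>
  consider "n = 1" | m where "n = Suc (Suc m)"
    using assms by (metis One_nat_def Suc_le_D not0_implies_Suc)
  then show ?thesis
  proof cases
    case 1
    show ?thesis unfolding sums by (simp add: 1)
  next
    case 2
    show ?thesis
      unfolding sums by (simp add: 2 choose2 field_simps del: binomial_Suc_Suc)
  qed
qed

end
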